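(* Let $A\in\mathbb{R}^{n\times n}$ be symmetric positive definite and assume that $u_k,v_k,r_k\in\mathbb{R}^n$ are not all null vectors. Then $\alpha_k^{new}$ has the form $$\alpha_k^{new}=\frac{1}{\frac{\mathrm{tr}(H_k)}{3}+2\cos\left(\frac{\theta_k}{3}\right)\sqrt{\frac{|p_k|}{3}}},$$ where $$\theta_k=\arccos\left(-\frac{q_k}{2}\left(\frac{3}{|p_k|}\right)^{3/2}\right),\qquad p_k=\frac{\mathrm{tr}^2(H_k)-3\,\mathrm{tr}(H_k^2)}{6},$$ and $$q_k=\frac{5\,\mathrm{tr}^3(H_k)-9\,\mathrm{tr}(H_k)\mathrm{tr}(H_k^2)}{54}-\det(H_k).$$
   Context: $H_k$ is the $3\times3$ matrix $$H_k=\begin{pmatrix}u_k^{\sf T}Au_k&u_k^{\sf T}Av_k&u_k^{\sf T}Ar_k\\ v_k^{\sf T}Au_k&v_k^{\sf T}Av_k&v_k^{\sf T}Ar_k\\ r_k^{\sf T}Au_k&r_k^{\sf T}Av_k&r_k^{\sf T}Ar_k\end{pmatrix},$$ and $\alpha_k^{new}$ is defined as the reciprocal of the largest root of the cubic equation $$z^3-\mathrm{tr}(H_k)z^2+\frac{\mathrm{tr}^2(H_k)-\mathrm{tr}(H_k^2)}{2}z-\det(H_k)=0.$$ Here $\mathrm{tr}^m(H_k)$ means $(\mathrm{tr}(H_k))^m$. *)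

theory Defs
  imports "HOL-Analysis.Analysis"
begin

definition sym_pos_def :: "real^'n^'n \<Rightarrow> bool" where
  "sym_pos_def A \<longleftrightarrow> transpose A = A \<and> (\<forall>x. x \<noteq> 0 \<longrightarrow> x \<bullet> (A *v x) > 0)"

definition H_mat :: "real^'n^'n \<Rightarrow> real^'n \<Rightarrow> real^'n \<Rightarrow> real^'n \<Rightarrow> real^3^3" where
  "H_mat A u v r = vector
    [vector [u \<bullet> (A *v u), u \<bullet> (A *v v), u \<bullet> (A *v r)],
     vector [v \<bullet> (A *v u), v \<bullet> (A *v v), v \<bullet> (A *v r)],
     vector [r \<bullet> (A *v u), r \<bullet> (A *v v), r \<bullet> (A *v r)]]"

definition cubic_roots :: "real^3^3 \<Rightarrow> real set" where
  "cubic_roots H =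
    {z. z ^ 3 - trace H * z ^ 2 + (trace H ^ 2 - trace (H ** H)) / 2 * z - det H = 0}"

text \<open>The set of real roots is always finite and nonempty, so its maximum is meaningful.\<close>

lemma finite_cubic_roots: "finite (cubic_roots H)"
proof -
  let ?p = "[: - det H, (trace H ^ 2 - trace (H ** H)) / 2, - trace H, 1 :]"
  have "finite {z. poly ?p z = 0}"
    by (rule poly_roots_finite) simp
  moreover have "cubic_roots H = {z. poly ?p z = 0}"
    by (auto simp: cubic_roots_def algebra_simps power2_eq_square power3_eq_cube)
  ultimately show ?thesis by simp
qed

lemma cubic_roots_nonempty: "cubic_roots H \<noteq> {}"
proof -
  define a where "a = trace H"
  define b where "b = (trace H ^ 2 - trace (H ** H)) / 2"
  define d where "d = det H"
  define M where "M = 1 + \<bar>a\<bar> + \<bar>b\<bar> + \<bar>d\<bar>"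
  define f where "f z = z ^ 3 - a * z ^ 2 + b * z - d" for z :: real
  have M1: "M \<ge> 1" by (simp add: M_def)
  have M3: "M ^ 3 = M ^ 2 + \<bar>a\<bar> * M ^ 2 + \<bar>b\<bar> * M ^ 2 + \<bar>d\<bar> * M ^ 2"
    by (simp add: M_def power3_eq_cube power2_eq_square algebra_simps)
  have MM: "M \<le> M ^ 2" "1 \<le> M ^ 2"
    using M1 by (simp_all add: self_le_power)
  have a: "\<bar>a * M ^ 2\<bar> = \<bar>a\<bar> * M ^ 2"
    by (simp add: abs_mult)
  have b: "\<bar>b * M\<bar> \<le> \<bar>b\<bar> * M ^ 2"
    using M1 MM by (simp add: abs_mult mult_left_mono)
  have d: "\<bar>d\<bar> \<le> \<bar>d\<bar> * M ^ 2"
    using MM(2) mult_left_mono[of 1 "M ^ 2" "\<bar>d\<bar>"] by simp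
  have "f M \<ge> 0"
    unfolding f_def using a b d M3 MM by linarith
  moreover have "f (- M) = - (M ^ 3) - a * M ^ 2 - b * M - d"
    by (simp add: f_def)
  then have "f (- M) \<le> 0"
    using a b d M3 MM by linarith
  moreover have "continuous_on {- M..M} f"
    unfolding f_def by (intro continuous_intros)
  ultimately obtain z where "f z = 0"
    using IVT'[of f "- M" 0 M] M1 by auto
  then have "z \<in> cubic_roots H"
    by (simp add: cubic_roots_def f_def a_def b_def d_def)
  then show ?thesis by blast
qed

definition largest_root :: "real^3^3 \<Rightarrow> real" where
  "largest_root H = Max (cubic_roots H)"

definition alpha_new :: "real^'n^'n \<Rightarrow> real^'n \<Rightarrow> real^'n \<Rightarrow> real^'n \<Rightarrow> real" where
  "alpha_new A u v r = 1 / largest_root (H_mat A u v r)"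

definition p_coef :: "real^3^3 \<Rightarrow> real" where
  "p_coef H = (trace H ^ 2 - 3 * trace (H ** H)) / 6"

definition q_coef :: "real^3^3 \<Rightarrow> real" where
  "q_coef H = (5 * trace H ^ 3 - 9 * trace H * trace (H ** H)) / 54 - det H"

text \<open>If \<open>p_coef H = 0\<close> (a triple root), the informal expression \<open>3 / |p|\<close> is undefined; here
  it is \<open>0\<close>, so \<open>cos_arg H = 0\<close>. This value is harmless, as the angle only enters the root
  formula through a product with \<open>sqrt (|p| / 3) = 0\<close>.\<close>

definition cos_arg :: "real^3^3 \<Rightarrow> real" where
  "cos_arg H = - (q_coef H / 2) * (3 / \<bar>p_coef H\<bar>) powr (3 / 2)"

definition theta :: "real^3^3 \<Rightarrow> real" where
  "theta H = arccos (cos_arg H)"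

end

theory Submission
  imports Defs
begin

text \<open>For a symmetric \<open>H\<close>, shifting the variable by \<open>trace H / 3\<close> replaces \<open>H\<close> by its deviatoric part
  \<open>B\<close> and the cubic by \<open>y\<^sup>3 + p y + q\<close> with \<open>p = - trace (B\<^sup>2) / 2\<close> and \<open>q = - det B\<close>. The
  Cauchy-Schwarz inequality for \<open>B\<close> and \<open>B\<^sup>2 - (trace (B\<^sup>2) / 3) I\<close> in the trace inner product says,
  by Cayley-Hamilton, exactly that \<open>27 q\<^sup>2 \<le> 4 (- p)\<^sup>3\<close>. Viete's substitution \<open>y = 2 s cos \<phi>\<close>
  with \<open>s = sqrt (- p / 3)\<close> then gives a root \<open>y \<ge> s\<close>, beyond which the cubic is increasing.\<close>

lemma depressed_cubic_largest_root:
  fixes s q y z :: real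
  assumes root: "y ^ 3 - 3 * s\<^sup>2 * y + q = 0" and z: "z ^ 3 - 3 * s\<^sup>2 * z + q = 0"
    and "0 \<le> s" "s \<le> y"
  shows "z \<le> y"
proof (rule ccontr)
  assume "\<not> z \<le> y"
  then have less: "y < z" by simp
  \<comment> \<open>Subtracting the two cubic equations leaves \<open>z - y\<close> times
    \<open>z * z + z * y + y * y - 3 * (s * s)\<close>. Each product there is at least
    \<open>s * s\<close>, and \<open>z * z\<close> strictly exceeds it.\<close>
  have "s * s \<le> y * y" "y * y \<le> z * y" "z * y < z * z"
    using assms(3,4) less by (auto intro: mult_mono mult_right_mono)
  then have "z * z + z * y + y * y - 3 * (s * s) > 0" by linarith
  then have "(z - y) * (z * z + z * y + y * y - 3 * (s * s)) > 0"
    using less by simp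
  moreover have "(z - y) * (z * z + z * y + y * y - 3 * (s * s)) = 0"
    using root z by (simp add: algebra_simps power2_eq_square power3_eq_cube)
  ultimately show False by simp
qed

text \<open>The triple-angle formula reduces the equation to
  \<open>cos (3 * \<phi>) = - q / (2 * s ^ 3)\<close>. The principal value of \<open>arccos\<close>
  puts \<phi> between 0 and pi / 3, so its cosine is at least 1 / 2; this selects the largest
  root.\<close>

lemma viete_depressed_cubic:
  fixes s q :: real
  assumes "0 < s" and c: "- q / (2 * s ^ 3) \<in> {-1..1}"
  defines "y \<equiv> 2 * cos (arccos (- q / (2 * s ^ 3)) / 3) * s"
  shows "y ^ 3 - 3 * s\<^sup>2 * y + q = 0" and "s \<le> y"
proof -
  define \<phi> where "\<phi> = arccos (- q / (2 * s ^ 3)) / 3"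
  have "cos (3 * \<phi>) = - q / (2 * s ^ 3)"
    using c by (simp add: \<phi>_def)
  then have "4 * cos \<phi> ^ 3 - 3 * cos \<phi> = - q / (2 * s ^ 3)"
    by (simp add: cos_treble_cos)
  then have "2 * s ^ 3 * (4 * cos \<phi> ^ 3 - 3 * cos \<phi>) = - q"
    using assms(1) by simp
  then show "y ^ 3 - 3 * s\<^sup>2 * y + q = 0"
    unfolding y_def \<phi>_def[symmetric]
    by (simp add: algebra_simps power2_eq_square power3_eq_cube)
  have "0 \<le> \<phi>" "\<phi> \<le> pi / 3"
    using arccos_bounded[of "- q / (2 * s ^ 3)"] c by (auto simp: \<phi>_def)
  then have "cos (pi / 3) \<le> cos \<phi>"
    by (intro cos_monotone_0_pi_le) auto
  then have "1 / 2 \<le> cos \<phi>" by (simp add: cos_60)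
  then show "s \<le> y"
    using assms(1) unfolding y_def \<phi>_def[symmetric] by simp
qed

lemma trace_3: "trace (M :: 'a::comm_ring_1^3^3) = M $ 1 $ 1 + M $ 2 $ 2 + M $ 3 $ 3"
  by (simp add: trace_def sum_3)

lemma mult_3_nth:
  "((M :: 'a::comm_ring_1^3^3) ** N) $ i $ j = M$i$1 * N$1$j + M$i$2 * N$2$j + M$i$3 * N$3$j"
  by (simp add: matrix_matrix_mult_def sum_3)

lemma symmetric_nth: "M $ i $ j = M $ j $ i" if "transpose M = M"
  using arg_cong[OF that, of "\<lambda>N. N $ i $ j"] by (simp add: transpose_def)

lemma inner_3_3:
  fixes M N :: "real^3^3"
  shows "M \<bullet> N = M$1$1 * N$1$1 + M$1$2 * N$1$2 + M$1$3 * N$1$3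
     + (M$2$1 * N$2$1 + M$2$2 * N$2$2 + M$2$3 * N$2$3)
     + (M$3$1 * N$3$1 + M$3$2 * N$3$2 + M$3$3 * N$3$3)"
  by (simp add: inner_vec_def sum_3)

lemma traceless_symmetric_det_bound:
  fixes B :: "real^3^3"
  assumes sym: "transpose B = B" and tr: "trace B = 0"
  shows "54 * (det B)\<^sup>2 \<le> trace (B ** B) ^ 3"
proof -
  define s where "s = trace (B ** B)"
  \<comment> \<open>The factor 3 avoids fractions. As B is traceless, Cayley-Hamilton gives trace 3
    det B for its cube and \<open>s\<^sup>2 / 2\<close> for its fourth power; this explains
    \<open>BC\<close> and \<open>CC\<close>, which are checked entrywise.\<close>
  define C where "C = 3 *\<^sub>R (B ** B) - mat s"
  have symB: "B$2$1 = B$1$2" "B$3$1 = B$1$3" "B$3$2 = B$2$3"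
    by (rule symmetric_nth[OF sym])+
  have trB: "B$3$3 = - B$1$1 - B$2$2"
    using tr by (simp add: trace_3)
  note expand = s_def C_def trace_3 mult_3_nth inner_3_3 mat_def det_3 symB trB
  have BB: "B \<bullet> B = s"
    by (simp add: expand)
  have BC: "B \<bullet> C = 9 * det B"
    by (simp add: expand) (simp add: algebra_simps)
  have CC: "2 * (C \<bullet> C) = 3 * s\<^sup>2"
    by (simp add: expand) (simp add: algebra_simps power2_eq_square)
  have "(B \<bullet> C)\<^sup>2 \<le> (B \<bullet> B) * (C \<bullet> C)"
    by (rule Cauchy_Schwarz_ineq)
  also have "\<dots> = 3 / 2 * s ^ 3"
    using CC unfolding BB by (simp add: power2_eq_square power3_eq_cube)
  finally have "81 * (det B)\<^sup>2 \<le> 3 / 2 * s ^ 3"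
    unfolding BC by (simp add: power_mult_distrib)
  then show ?thesis
    by (simp add: s_def)
qed

text \<open>The second bound says that the discriminant of the depressed cubic is nonnegative, so
  that all its roots are real. It is obtained without eigenvalues.\<close>

lemma symmetric_p_coef_q_coef:
  fixes H :: "real^3^3"
  assumes sym: "transpose H = H"
  shows "p_coef H \<le> 0" and "27 * (q_coef H)\<^sup>2 \<le> 4 * (- p_coef H) ^ 3"
proof -
  define m where "m = trace H / 3"
  define B where "B = H - mat m"
  have trH: "H$3$3 = 3 * m - H$1$1 - H$2$2"
    unfolding m_def trace_3 by (simp add: add_divide_distrib)
  have symH: "H$2$1 = H$1$2" "H$3$1 = H$1$3" "H$3$2 = H$2$3"
    by (rule symmetric_nth[OF sym])+
  have symB: "transpose B = B"
    by (simp add: B_def transpose_def mat_def vec_eq_iff forall_3 symH)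
  have trB: "trace B = 0"
    by (simp add: B_def trace_3 mat_def trH)
  note expand = B_def trace_3 mult_3_nth mat_def det_3 symH trH
  have "trace (B ** B) = trace (H ** H) - 3 * m\<^sup>2"
    by (simp add: expand) (simp add: algebra_simps power2_eq_square)
  then have p: "trace (B ** B) = - 2 * p_coef H"
    by (simp add: p_coef_def m_def power2_eq_square field_simps)
  \<comment> \<open>det B is minus the characteristic polynomial of H at m, that is, minus the
    depressed cubic at 0.\<close>
  have "2 * det B = 2 * det H + m * trace (H ** H) - 5 * m ^ 3"
    by (simp add: expand) (simp add: algebra_simps power2_eq_square power3_eq_cube)
  then have q: "det B = - q_coef H"
    by (simp add: q_coef_def m_def power3_eq_cube field_simps)
  have "trace (B ** B) = B \<bullet> B"
    using symB by (simp add: trace_3 mult_3_nth inner_3_3 B_def mat_def symH)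
  then show "p_coef H \<le> 0"
    using p inner_ge_zero[of B] by linarith
  show "27 * (q_coef H)\<^sup>2 \<le> 4 * (- p_coef H) ^ 3"
    using traceless_symmetric_det_bound[OF symB trB]
    unfolding p q by (simp add: power_mult_distrib)
qed

lemma cubic_roots_iff_depressed:
  "z \<in> cubic_roots H \<longleftrightarrow>
    (z - trace H / 3) ^ 3 + p_coef H * (z - trace H / 3) + q_coef H = 0"
proof -
  have "z ^ 3 - t * z\<^sup>2 + (t\<^sup>2 - w) / 2 * z - d =
    (z - t / 3) ^ 3 + (t\<^sup>2 - 3 * w) / 6 * (z - t / 3) + ((5 * t ^ 3 - 9 * t * w) / 54 - d)"
    for t w d :: real
    by (simp add: power2_eq_square power3_eq_cube diff_divide_distrib add_divide_distrib
        algebra_simps)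
  then show ?thesis
    unfolding cubic_roots_def p_coef_def q_coef_def mem_Collect_eq by presburger
qed

lemma symmetric_largest_root:
  fixes H :: "real^3^3"
  assumes sym: "transpose H = H"
  defines "y \<equiv> 2 * cos (theta H / 3) * sqrt (\<bar>p_coef H\<bar> / 3)"
  shows "cos_arg H \<in> {-1..1}" and "0 \<le> y" and "largest_root H = trace H / 3 + y"
proof -
  define s where "s = sqrt (\<bar>p_coef H\<bar> / 3)"
  define q where "q = q_coef H"
  have s0: "0 \<le> s" by (simp add: s_def)
  have ps: "p_coef H = - 3 * s\<^sup>2"
    using symmetric_p_coef_q_coef(1)[OF sym] by (simp add: s_def)
  \<comment> \<open>With \<open>- p_coef H = 3 * s\<^sup>2\<close>, the bound
    \<open>4 * (- p_coef H) ^ 3\<close> is \<open>108 * s ^ 6\<close>.\<close>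
  have "27 * q\<^sup>2 \<le> 27 * (2 * s ^ 3)\<^sup>2"
    using symmetric_p_coef_q_coef(2)[OF sym]
    unfolding ps q_def by (simp add: power_mult_distrib flip: power_mult)
  then have "\<bar>q\<bar> \<le> \<bar>2 * s ^ 3\<bar>"
    by (simp only: abs_le_square_iff)
  then have q: "\<bar>q\<bar> \<le> 2 * s ^ 3"
    using s0 by simp
  have main: "cos_arg H \<in> {-1..1} \<and> y ^ 3 - 3 * s\<^sup>2 * y + q = 0 \<and> s \<le> y"
  proof (cases "s = 0")
    \<comment> \<open>Triple root: p and q vanish, hence so do \<open>cos_arg H\<close> and
      y.\<close>
    case True
    then show ?thesis
      using q ps by (simp add: cos_arg_def y_def flip: s_def)
  next
    case False
    then have s: "0 < s" using s0 by simp
    \<comment> \<open>Writing the square as a \<open>powr\<close> lets the exponents multiply to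
      3.\<close>
    have "(3 / \<bar>p_coef H\<bar>) powr (3 / 2) = ((1 / s) powr 2) powr (3 / 2)"
      using s by (simp add: ps power_divide abs_mult)
    also have "\<dots> = (1 / s) ^ 3"
      unfolding powr_powr using s by (simp add: powr_numeral[symmetric] del: powr_numeral)
    finally have "cos_arg H = - q / (2 * s ^ 3)"
      by (simp add: cos_arg_def q_def power_divide)
    moreover have "- q / (2 * s ^ 3) \<in> {-1..1}"
      using q s by (simp add: pos_divide_le_eq pos_le_divide_eq abs_le_iff)
    ultimately show ?thesis
      using viete_depressed_cubic[OF s, of q] by (simp add: y_def theta_def s_def)
  qed
  then show "cos_arg H \<in> {-1..1}" "0 \<le> y"
    using s0 by auto
  show "largest_root H = trace H / 3 + y"
    unfolding largest_root_def
  proof (rule Max_eqI[OF finite_cubic_roots])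
    show "trace H / 3 + y \<in> cubic_roots H"
      using main by (simp add: cubic_roots_iff_depressed ps q_def)
    fix z assume "z \<in> cubic_roots H"
    then have "(z - trace H / 3) ^ 3 - 3 * s\<^sup>2 * (z - trace H / 3) + q = 0"
      by (simp add: cubic_roots_iff_depressed ps q_def)
    then show "z \<le> trace H / 3 + y"
      using depressed_cubic_largest_root[of y s q "z - trace H / 3"] main s0 by linarith
  qed
qed

lemma H_mat_symmetric:
  assumes "transpose A = A"
  shows "transpose (H_mat A u v r) = H_mat A u v r"
proof -
  have "x \<bullet> (A *v y) = y \<bullet> (A *v x)" for x y
    using dot_lmul_matrix[of y A x] assms
    by (metis inner_commute transpose_matrix_vector)
  then show ?thesis
    by (simp add: H_mat_def transpose_def vec_eq_iff forall_3)
qed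

lemma trace_H_mat: "trace (H_mat A u v r) = u \<bullet> (A *v u) + v \<bullet> (A *v v) + r \<bullet> (A *v r)"
  by (simp add: H_mat_def trace_3)

lemma trace_H_mat_pos:
  assumes "sym_pos_def A" "\<not> (u = 0 \<and> v = 0 \<and> r = 0)"
  shows "0 < trace (H_mat A u v r)"
proof -
  have pos: "x \<bullet> (A *v x) > 0" if "x \<noteq> 0" for x
    using assms(1) that by (simp add: sym_pos_def_def)
  then have "x \<bullet> (A *v x) \<ge> 0" for x
    by (cases "x = 0") (auto intro: less_imp_le)
  then show ?thesis
    unfolding trace_H_mat using pos assms(2)
    by (metis add_nonneg_pos add_pos_nonneg add_nonneg_nonneg)
qed

theorem lemma2p3:
  fixes A :: "real^'n^'n" and u v r :: "real^'n"
  assumes "sym_pos_def A"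
    and "\<not> (u = 0 \<and> v = 0 \<and> r = 0)"
  shows "largest_root (H_mat A u v r) \<noteq> 0
    \<and> cos_arg (H_mat A u v r) \<in> {-1..1}
    \<and> alpha_new A u v r =
        1 / (trace (H_mat A u v r) / 3
             + 2 * cos (theta (H_mat A u v r) / 3) * sqrt (\<bar>p_coef (H_mat A u v r)\<bar> / 3))"
proof -
  have "transpose (H_mat A u v r) = H_mat A u v r"
    using assms(1) by (simp add: sym_pos_def_def H_mat_symmetric)
  note root = symmetric_largest_root[OF this]
  \<comment> \<open>The largest root is at least the mean \<open>trace / 3\<close> of the
    eigenvalues, which is positive, so its reciprocal is a genuine one.\<close>
  have "largest_root (H_mat A u v r) > 0"
    using root(2,3) trace_H_mat_pos[OF assms] by linarith
  then show ?thesis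
    using root(1,3) by (simp add: alpha_new_def)
qed

end
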